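(* Let $C$ be a normal cone in a Banach space $(X,\|\cdot\|)$, with nonempty interior. Let $h:C\to C$ be a continuous, homogeneous, and order-preserving map. Consider the following conditions: (i) $h$ is uniformly continuous on bounded sets of $C$; (ii) $\nu_C(h)<\operatorname{cw}_C(h)$; (iii) $\rho_C(h)<\operatorname{cw}_C(h)$. If (i) or (ii) holds, then $r_C(h)=\operatorname{cw}_C(h)$. If ((i) and (iii)) or (ii) holds, then $\hat r_C(h)=r_C(h)$ and there exists an element $x\in C\setminus\{0\}$ such that $h(x)=r_C(h)\,x$.
   Context: A subset $C$ of the real Banach space $X$ is a cone if $tC\subset C$ for all $t\ge 0$; it is proper if it is closed, convex and pointed ($C\cap(-C)=\{0\}$). A proper cone induces the partial order $x\le y\iff y-x\in C$. $C$ is normal if it is proper and there is a constant $M$ with $\|x\|\le M\|y\|$ whenever $0\le x\le y$. Homogeneous: $h(tx)=th(x)$ for all $t>0$, $x\in C$. Order-preserving: $x\le y$ implies $h(x)\le h(y)$. $h^k$ is the $k$-th iterate. Cone spectral radius: $r_C(h)=\sup_{x\in C}\limsup_{k\to\infty}\|h^k(x)\|^{1/k}$. Cone eigenvalue spectral radius: $\hat r_C(h)=\sup\{\lambda\ge0\mid\exists x\in C\setminus\{0\},\ h(x)=\lambda x\}$ (supremum in $[0,+\infty]$). Collatz-Wielandt number: $\operatorname{cw}_C(h)=\inf\{\lambda>0\mid\exists x\in\operatorname{int}C,\ h(x)\le\lambda x\}$. Fix a homogeneous generalized measure of noncompactness $\nu$ on $X$, that is, a map $\nu$ from the bounded subsets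 of $X$ to $[0,\infty)$ such that, for all bounded $A,B\subset X$ and scalars $\lambda$: $\nu(A)=0$ iff $\operatorname{cl}A$ is compact; $\nu(A+B)\le\nu(A)+\nu(B)$; $\nu(\operatorname{cl}\operatorname{conv}A)=\nu(A)$; $\nu(\lambda A)=|\lambda|\nu(A)$; $A\subset B$ implies $\nu(A)\le\nu(B)$. Set $\nu_C(h)=\inf\{\lambda>0\mid \nu(h(A))\le\lambda\nu(A)\text{ for all bounded }A\subset C\}$. The cone essential spectral radius is $\rho_C(h)=\lim_{k\to\infty}\nu_C(h^k)^{1/k}=\inf_{k\ge1}\nu_C(h^k)^{1/k}$. *)

theory Defs
  imports "HOL-Analysis.Analysis"
begin

definition proper_cone :: "'a::real_normed_vector set \<Rightarrow> bool" where
  "proper_cone C \<longleftrightarrow> cone C \<and> closed C \<and> convex C \<and> C \<inter> uminus ` C = {0}"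

definition cone_le :: "'a::real_normed_vector set \<Rightarrow> 'a \<Rightarrow> 'a \<Rightarrow> bool" where
  "cone_le C x y \<longleftrightarrow> y - x \<in> C"

definition normal_cone :: "'a::real_normed_vector set \<Rightarrow> bool" where
  "normal_cone C \<longleftrightarrow> proper_cone C \<and>
     (\<exists>M::real. \<forall>x y. cone_le C 0 x \<and> cone_le C x y \<longrightarrow> norm x \<le> M * norm y)"

definition homogeneous_on :: "'a::real_normed_vector set \<Rightarrow> ('a \<Rightarrow> 'a) \<Rightarrow> bool" where
  "homogeneous_on C h \<longleftrightarrow> (\<forall>t>0. \<forall>x\<in>C. h (t *\<^sub>R x) = t *\<^sub>R h x)"

definition order_preserving_on :: "'a::real_normed_vector set \<Rightarrow> ('a \<Rightarrow> 'a) \<Rightarrow> bool" where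
  "order_preserving_on C h \<longleftrightarrow> (\<forall>x\<in>C. \<forall>y\<in>C. cone_le C x y \<longrightarrow> cone_le C (h x) (h y))"

definition uniformly_continuous_on_bounded_subsets ::
    "'a::real_normed_vector set \<Rightarrow> ('a \<Rightarrow> 'a) \<Rightarrow> bool" where
  "uniformly_continuous_on_bounded_subsets C h \<longleftrightarrow>
     (\<forall>B. B \<subseteq> C \<and> bounded B \<longrightarrow> uniformly_continuous_on B h)"

text \<open>
  The spectral quantities below take values in \<^typ>\<open>ennreal\<close>, that is in $[0,+\infty]$,
  so that the supremum of the empty set is $0$ and the infimum of the empty set is $+\infty$.
\<close>

definition cone_spectral_radius :: "'a::real_normed_vector set \<Rightarrow> ('a \<Rightarrow> 'a) \<Rightarrow> ennreal" where
  "cone_spectral_radius C h =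
     (SUP x\<in>C. limsup (\<lambda>k. ennreal (root k (norm ((h ^^ k) x)))))"

definition cone_eigenvalue_spectral_radius ::
    "'a::real_normed_vector set \<Rightarrow> ('a \<Rightarrow> 'a) \<Rightarrow> ennreal" where
  "cone_eigenvalue_spectral_radius C h =
     Sup {ennreal l | l::real. 0 \<le> l \<and> (\<exists>x \<in> C - {0}. h x = l *\<^sub>R x)}"

definition collatz_wielandt_number :: "'a::real_normed_vector set \<Rightarrow> ('a \<Rightarrow> 'a) \<Rightarrow> ennreal" where
  "collatz_wielandt_number C h =
     Inf {ennreal l | l::real. 0 < l \<and> (\<exists>x \<in> interior C. cone_le C (h x) (l *\<^sub>R x))}"

text \<open>
  A homogeneous generalized measure of noncompactness is a map on the bounded sets only:
  its values on unbounded sets are left unconstrained.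
\<close>

definition homogeneous_gen_mnc :: "('a::real_normed_vector set \<Rightarrow> real) \<Rightarrow> bool" where
  "homogeneous_gen_mnc \<nu> \<longleftrightarrow>
     (\<forall>A. bounded A \<longrightarrow> 0 \<le> \<nu> A) \<and>
     (\<forall>A. bounded A \<longrightarrow> (\<nu> A = 0 \<longleftrightarrow> compact (closure A))) \<and>
     (\<forall>A B. bounded A \<and> bounded B \<longrightarrow> \<nu> (A + B) \<le> \<nu> A + \<nu> B) \<and>
     (\<forall>A. bounded A \<longrightarrow> \<nu> (closure (convex hull A)) = \<nu> A) \<and>
     (\<forall>A (c::real). bounded A \<longrightarrow> \<nu> ((*\<^sub>R) c ` A) = \<bar>c\<bar> * \<nu> A) \<and>
     (\<forall>A B. bounded A \<and> bounded B \<and> A \<subseteq> B \<longrightarrow> \<nu> A \<le> \<nu> B)"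

text \<open>
  Boundedness of \<open>h ` A\<close> is part of the requirement that \<open>\<nu> (h ` A)\<close> makes sense. It holds
  automatically for order-preserving homogeneous self-maps of a normal cone with nonempty interior.
\<close>

definition mnc_seminorm ::
    "('a::real_normed_vector set \<Rightarrow> real) \<Rightarrow> 'a set \<Rightarrow> ('a \<Rightarrow> 'a) \<Rightarrow> ennreal" where
  "mnc_seminorm \<nu> C h =
     Inf {ennreal l | l::real. 0 < l \<and>
       (\<forall>A. A \<subseteq> C \<and> bounded A \<longrightarrow> bounded (h ` A) \<and> \<nu> (h ` A) \<le> l * \<nu> A)}"

definition ennroot :: "nat \<Rightarrow> ennreal \<Rightarrow> ennreal" where
  "ennroot k a = (if a = top then top else ennreal (root k (enn2real a)))"

text \<open>
  The essential spectral radius is given by the infimum formula, which, unlike the limit, is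
  meaningful without any finiteness assumption. Submultiplicativity makes the lower limit of
  \<open>\<nu>\<^sub>C(h\<^sup>k)\<close> to the power $1/k$ equal to this infimum, so the two formulas agree whenever
  the limit exists, in particular whenever $\nu_C(h)$ is finite.
\<close>

definition cone_essential_spectral_radius ::
    "('a::real_normed_vector set \<Rightarrow> real) \<Rightarrow> 'a set \<Rightarrow> ('a \<Rightarrow> 'a) \<Rightarrow> ennreal" where
  "cone_essential_spectral_radius \<nu> C h =
     (INF k\<in>{1..}. ennroot k (mnc_seminorm \<nu> C (h ^^ k)))"

end

theory Submission
  imports Defs
begin

text \<open>
  Let \<open>r\<close> be the Collatz--Wielandt number, assumed positive, and \<open>u\<close> an interior point of the
  cone. For every \<open>l > r\<close> the equation \<open>l x = h x + u\<close> has a solution: iterating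
  \<open>x \<mapsto> (h x + u) / l\<close> from a point that it decreases gives a sequence which converges
  geometrically, because adding \<open>u\<close> makes the map a strict contraction in Thompson's metric on
  order-bounded sets. If \<open>x \<le> R u\<close>, then \<open>h x \<le> (l - 1 / R) x\<close>, hence \<open>r \<le> l - 1 / R\<close>; so
  \<open>x\<close> blows up as \<open>l\<close> decreases to \<open>r\<close>, and the normalised solutions \<open>y\<close> satisfy
  \<open>h y - r y \<longrightarrow> 0\<close>. Under uniform continuity also \<open>h\<^sup>k y - r\<^sup>k y \<longrightarrow> 0\<close>, so the iterates of \<open>h\<close>
  grow at least like \<open>r\<^sup>k\<close>. If \<open>\<nu>\<^sub>C(h\<^sup>k) < r\<^sup>k\<close>, the set of the \<open>y\<close> has measure of
  noncompactness \<open>0\<close>, and a cluster point is an eigenvector for \<open>r\<close>.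
\<close>

section \<open>Exponential growth rates and k-th roots\<close>

lemma limsup_root_le:
  fixes a :: "nat \<Rightarrow> real"
  assumes "0 \<le> l" and bd: "\<And>k. a k \<le> D * l ^ k"
  shows "limsup (\<lambda>k. ennreal (root k (a k))) \<le> ennreal l"
proof -
  \<comment> \<open>\<open>D\<close> may be nonpositive, whereas \<open>root k D'\<close> tends to 1
    for positive \<open>D'\<close>; the constant then disappears in the limit.\<close>
  define D' where "D' = max D 1"
  have "(\<lambda>k. root k D' * l) \<longlonglongrightarrow> 1 * l"
    by (intro tendsto_intros LIMSEQ_root_const) (simp add: D'_def)
  then have lim: "(\<lambda>k. ennreal (root k D' * l)) \<longlonglongrightarrow> ennreal l"
    using tendsto_ennrealI by fastforce
  have "\<forall>\<^sub>F k in sequentially. ennreal (root k (a k)) \<le> ennreal (root k D' * l)"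
    using eventually_gt_at_top[of 0]
  proof eventually_elim
    case (elim k)
    have "a k \<le> D' * l ^ k"
      using bd[of k] mult_right_mono[of D D' "l ^ k"] assms(1) by (auto simp: D'_def)
    then have "root k (a k) \<le> root k (D' * l ^ k)"
      using elim by simp
    also have "\<dots> = root k D' * l"
      using elim assms(1) by (simp add: real_root_mult real_root_power_cancel)
    finally show ?case by (rule ennreal_leI)
  qed
  then have "limsup (\<lambda>k. ennreal (root k (a k))) \<le> limsup (\<lambda>k. ennreal (root k D' * l))"
    by (rule Limsup_mono)
  also have "\<dots> = ennreal l"
    using lim by (intro lim_imp_Limsup) auto
  finally show ?thesis .
qed

lemma limsup_root_ge:
  fixes a :: "nat \<Rightarrow> real"
  assumes "0 \<le> l" and "0 < D" and bd: "\<And>k. D * l ^ k \<le> a k"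
  shows "ennreal l \<le> limsup (\<lambda>k. ennreal (root k (a k)))"
proof -
  have "(\<lambda>k. root k D * l) \<longlonglongrightarrow> 1 * l"
    by (intro tendsto_intros LIMSEQ_root_const assms)
  then have lim: "(\<lambda>k. ennreal (root k D * l)) \<longlonglongrightarrow> ennreal l"
    using tendsto_ennrealI by fastforce
  have "\<forall>\<^sub>F k in sequentially. ennreal (root k D * l) \<le> ennreal (root k (a k))"
    using eventually_gt_at_top[of 0]
  proof eventually_elim
    case (elim k)
    have "root k D * l = root k (D * l ^ k)"
      using elim assms(1) by (simp add: real_root_mult real_root_power_cancel)
    also have "\<dots> \<le> root k (a k)"
      using elim bd[of k] by simp
    finally show ?case by (rule ennreal_leI)
  qed
  then have "limsup (\<lambda>k. ennreal (root k D * l)) \<le> limsup (\<lambda>k. ennreal (root k (a k)))"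
    by (rule Limsup_mono)
  moreover have "limsup (\<lambda>k. ennreal (root k D * l)) = ennreal l"
    using lim by (intro lim_imp_Limsup) auto
  ultimately show ?thesis by simp
qed

text \<open>Serves to show that a null sequence of error terms is relatively compact and so has
  measure of noncompactness 0.\<close>

lemma compact_insert_limit:
  fixes f :: "nat \<Rightarrow> 'b::topological_space"
  assumes "f \<longlonglongrightarrow> l"
  shows "compact (insert l (range f))"
proof (rule compactI)
  fix \<C> assume op: "\<forall>U\<in>\<C>. open U" and cover: "insert l (range f) \<subseteq> \<Union>\<C>"
  obtain U where U: "U \<in> \<C>" "l \<in> U" using cover by auto
  then obtain N where N: "\<And>n. n \<ge> N \<Longrightarrow> f n \<in> U"
    using topological_tendstoD[OF assms, of U] op by (auto simp: eventually_sequentially)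
  have "\<forall>n. \<exists>V. V \<in> \<C> \<and> f n \<in> V" using cover by auto
  then obtain V where V: "\<And>n. V n \<in> \<C>" "\<And>n. f n \<in> V n" by metis
  show "\<exists>\<C>'\<subseteq>\<C>. finite \<C>' \<and> insert l (range f) \<subseteq> \<Union>\<C>'"
  proof (intro exI conjI)
    show "insert l (range f) \<subseteq> \<Union>(insert U (V ` {..<N}))"
      using U N V(2) by (force simp: not_le)
  qed (use U(1) V(1) in auto)
qed

section \<open>The cone, its order and its interior\<close>

locale solid_normal_cone_map =
  fixes C :: "'a::banach set" and h :: "'a \<Rightarrow> 'a" and u :: 'a
  assumes normal: "normal_cone C"
    and u_interior: "u \<in> interior C"
    and self_map: "h \<in> C \<rightarrow> C"
    and cont: "continuous_on C h"
    and homogeneous: "homogeneous_on C h"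
    and order_preserving: "order_preserving_on C h"
begin

abbreviation le (infix "\<preceq>" 50) where "x \<preceq> y \<equiv> cone_le C x y"

lemma closed_C: "closed C" and convex_C: "convex C" and cone_C: "cone C"
  using normal by (auto simp: normal_cone_def proper_cone_def)

lemma zero_mem: "0 \<in> C"
  using normal by (auto simp: normal_cone_def proper_cone_def)

lemma add_mem: "x \<in> C \<Longrightarrow> y \<in> C \<Longrightarrow> x + y \<in> C"
  using convex_cone[of C] convex_C cone_C by blast

lemma scale_mem: "x \<in> C \<Longrightarrow> 0 \<le> t \<Longrightarrow> t *\<^sub>R x \<in> C"
  using cone_C by (auto simp: cone_def)

lemma zero_le_iff: "0 \<preceq> x \<longleftrightarrow> x \<in> C"
  by (simp add: cone_le_def)

lemma le_refl: "x \<preceq> x"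
  by (simp add: cone_le_def zero_mem)

lemma le_trans [trans]: "x \<preceq> y \<Longrightarrow> y \<preceq> z \<Longrightarrow> x \<preceq> z"
  using add_mem[of "y - x" "z - y"] by (simp add: cone_le_def)

lemma le_add: "x \<preceq> y \<Longrightarrow> x' \<preceq> y' \<Longrightarrow> x + x' \<preceq> y + y'"
  using add_mem[of "y - x" "y' - x'"] by (simp add: cone_le_def algebra_simps)

lemma le_scale: "x \<preceq> y \<Longrightarrow> 0 \<le> t \<Longrightarrow> t *\<^sub>R x \<preceq> t *\<^sub>R y"
  using scale_mem[of "y - x" t] by (simp add: cone_le_def algebra_simps)

lemma scale_le_scale: "x \<in> C \<Longrightarrow> s \<le> t \<Longrightarrow> s *\<^sub>R x \<preceq> t *\<^sub>R x"
  using scale_mem[of x "t - s"] by (simp add: cone_le_def algebra_simps)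

lemma mem_upward: "x \<in> C \<Longrightarrow> x \<preceq> y \<Longrightarrow> y \<in> C"
  using add_mem[of x "y - x"] by (simp add: cone_le_def)

lemma interior_mem: "z \<in> interior C \<Longrightarrow> z \<in> C"
  using interior_subset by blast

text \<open>Translation by \<open>w - z\<close>, an element of the cone, carries a ball around
  \<open>z\<close> inside \<open>C\<close> to a ball around \<open>w\<close> inside
  \<open>C\<close>.\<close>

lemma interior_upward:
  assumes "z \<in> interior C" and "z \<preceq> w"
  shows "w \<in> interior C"
proof -
  obtain e where "e > 0" and e: "ball z e \<subseteq> C"
    using assms(1) mem_interior by blast
  have "ball w e \<subseteq> C"
  proof
    fix v assume "v \<in> ball w e"
    then have "v - (w - z) \<in> ball z e"
      by (simp add: dist_norm algebra_simps)
    then show "v \<in> C"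
      using e add_mem[of "v - (w - z)" "w - z"] assms(2) by (auto simp: cone_le_def)
  qed
  with \<open>e > 0\<close> show ?thesis
    using mem_interior by blast
qed

lemma interior_scale:
  assumes "z \<in> interior C" and "0 < t"
  shows "t *\<^sub>R z \<in> interior C"
proof (rule interiorI)
  show "open ((*\<^sub>R) t ` interior C)"
    using assms(2) by (intro open_scaling) auto
  show "(*\<^sub>R) t ` interior C \<subseteq> C"
    using assms(2) by (auto intro: scale_mem interior_mem)
  show "t *\<^sub>R z \<in> (*\<^sub>R) t ` interior C"
    using assms(1) by (rule imageI)
qed

text \<open>A vector of norm \<open>e\<close> can be subtracted from \<open>z\<close> without
  leaving a ball inside \<open>C\<close>; scaling back gives \<open>K = 1 / e\<close>, uniformly in
  \<open>x\<close>. The vector \<open>x\<close> itself may lie outside the cone.\<close>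

lemma order_unit:
  assumes "z \<in> interior C"
  obtains K where "K > 0" and "\<And>x. x \<preceq> (K * norm x) *\<^sub>R z"
proof -
  obtain e where e: "e > 0" "cball z e \<subseteq> C"
    using assms mem_interior_cball by blast
  have "x \<preceq> ((1 / e) * norm x) *\<^sub>R z" for x
  proof (cases "x = 0")
    case True
    then show ?thesis by (simp add: le_refl)
  next
    case False
    have "z - (e / norm x) *\<^sub>R x \<in> cball z e"
      using False e(1) by (simp add: dist_norm)
    then have "(norm x / e) *\<^sub>R (z - (e / norm x) *\<^sub>R x) \<in> C"
      using e by (intro scale_mem) auto
    then show ?thesis
      using False e(1) by (simp add: cone_le_def scaleR_diff_right)
  qed
  then show ?thesis
    using that[of "1 / e"] e(1) by simp
qed

lemma normality:
  obtains M where "M > 0" and "\<And>x y. x \<in> C \<Longrightarrow> x \<preceq> y \<Longrightarrow> norm x \<le> M * norm y"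
proof -
  obtain M where M: "\<And>x y. 0 \<preceq> x \<Longrightarrow> x \<preceq> y \<Longrightarrow> norm x \<le> M * norm y"
    using normal unfolding normal_cone_def by blast
  \<comment> \<open>The constant is raised to at least 1 because positivity is wanted for later
    divisions.\<close>
  have "norm x \<le> max M 1 * norm y" if "x \<in> C" "x \<preceq> y" for x y
    using M[of x y] that mult_right_mono[of M "max M 1" "norm y"] by (force simp: zero_le_iff)
  then show ?thesis
    using that[of "max M 1"] by simp
qed

section \<open>The map and its iterates\<close>

lemma map_mem: "x \<in> C \<Longrightarrow> h x \<in> C"
  using self_map by auto

lemma map_mono: "x \<in> C \<Longrightarrow> x \<preceq> y \<Longrightarrow> h x \<preceq> h y"
  using order_preserving mem_upward unfolding order_preserving_on_def by blast

lemma map_scale: "x \<in> C \<Longrightarrow> 0 < t \<Longrightarrow> h (t *\<^sub>R x) = t *\<^sub>R h x"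
  using homogeneous unfolding homogeneous_on_def by blast

lemma map_zero: "h 0 = 0"
  \<comment> \<open>Homogeneity covers positive factors; the factor 2 gives
    \<open>h 0 = 2 h 0\<close>.\<close>
  using map_scale[of 0 2] zero_mem by (simp add: scaleR_2)

lemma iter_mem: "x \<in> C \<Longrightarrow> (h ^^ k) x \<in> C"
  by (induction k) (auto intro: map_mem)

lemma iter_mono: "x \<in> C \<Longrightarrow> x \<preceq> y \<Longrightarrow> (h ^^ k) x \<preceq> (h ^^ k) y"
  by (induction k) (auto intro: map_mono iter_mem)

lemma iter_scale: "x \<in> C \<Longrightarrow> 0 < t \<Longrightarrow> (h ^^ k) (t *\<^sub>R x) = t *\<^sub>R (h ^^ k) x"
  by (induction k) (auto simp: map_scale iter_mem)

lemma iter_le_power: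
  assumes "x \<in> C" and "h x \<preceq> l *\<^sub>R x" and "0 < l"
  shows "(h ^^ k) x \<preceq> (l ^ k) *\<^sub>R x"
proof (induction k)
  case 0
  show ?case by (simp add: le_refl)
next
  case (Suc k)
  have "h ((h ^^ k) x) \<preceq> h ((l ^ k) *\<^sub>R x)"
    using Suc assms(1) by (intro map_mono iter_mem)
  also have "h ((l ^ k) *\<^sub>R x) = (l ^ k) *\<^sub>R h x"
    using assms by (simp add: map_scale)
  also have "(l ^ k) *\<^sub>R h x \<preceq> (l ^ k) *\<^sub>R (l *\<^sub>R x)"
    using assms by (intro le_scale) auto
  finally show ?case by (simp add: mult.commute)
qed

lemma iter_eigenvector:
  assumes "x \<in> C" and "h x = l *\<^sub>R x" and "0 < l"
  shows "(h ^^ k) x = (l ^ k) *\<^sub>R x"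
proof (induction k)
  case (Suc k)
  then show ?case
    using assms by (simp add: map_scale mult.commute)
qed simp

section \<open>Finiteness of the Collatz-Wielandt number and comparison of the radii\<close>

lemma cw_le:
  "0 < l \<Longrightarrow> z \<in> interior C \<Longrightarrow> h z \<preceq> l *\<^sub>R z \<Longrightarrow> collatz_wielandt_number C h \<le> ennreal l"
  unfolding collatz_wielandt_number_def by (rule Inf_lower) auto

lemma cw_finite: "collatz_wielandt_number C h < top"
proof -
  obtain K where K: "K > 0" "\<And>x. x \<preceq> (K * norm x) *\<^sub>R u"
    using order_unit u_interior by blast
  \<comment> \<open>The summand 1 keeps the factor positive even if \<open>h u = 0\<close>, as an
    admissible factor must be.\<close>
  have "h u \<preceq> (K * norm (h u) + 1) *\<^sub>R u"
    using K(2)[of "h u"] by (rule le_trans) (simp add: scale_le_scale interior_mem[OF u_interior])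
  moreover have "0 < K * norm (h u) + 1"
    using K(1) by (simp add: add_nonneg_pos)
  ultimately show ?thesis
    using cw_le[OF _ u_interior] ennreal_less_top le_less_trans by blast
qed

text \<open>Every \<open>x\<close> in the cone lies below a multiple of \<open>z\<close>. Iteration
  preserves this and \<open>z\<close> grows at most like \<open>l ^ k\<close>; normality turns the
  order bound into a norm bound.\<close>

lemma spectral_radius_le_cw: "cone_spectral_radius C h \<le> collatz_wielandt_number C h"
  unfolding cone_spectral_radius_def collatz_wielandt_number_def
proof (rule SUP_least, rule Inf_greatest)
  fix x b assume x: "x \<in> C"
    and "b \<in> {ennreal l |l. 0 < l \<and> (\<exists>z\<in>interior C. h z \<preceq> l *\<^sub>R z)}"
  then obtain l z where b: "b = ennreal l" and l: "0 < l"
    and z: "z \<in> interior C" "h z \<preceq> l *\<^sub>R z"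
    by blast
  obtain K where K: "K > 0" "\<And>x. x \<preceq> (K * norm x) *\<^sub>R z"
    using order_unit z(1) by blast
  obtain M where M: "M > 0" "\<And>x y. x \<in> C \<Longrightarrow> x \<preceq> y \<Longrightarrow> norm x \<le> M * norm y"
    using normality by blast
  define s where "s = K * norm x + 1"
  have s: "0 < s" "x \<preceq> s *\<^sub>R z"
    using K(1) le_trans[OF K(2)[of x]] interior_mem[OF z(1)] scale_le_scale
    by (auto simp: s_def add_nonneg_pos)
  have "norm ((h ^^ k) x) \<le> (M * s * norm z) * l ^ k" for k
  proof -
    have "(h ^^ k) x \<preceq> s *\<^sub>R (h ^^ k) z"
      using iter_mono[OF x s(2)] iter_scale[OF interior_mem[OF z(1)] s(1)] by metis
    also have "s *\<^sub>R (h ^^ k) z \<preceq> s *\<^sub>R (l ^ k) *\<^sub>R z"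
      using iter_le_power[OF interior_mem[OF z(1)] z(2) l] s(1) by (intro le_scale) auto
    finally have "norm ((h ^^ k) x) \<le> M * norm (s *\<^sub>R (l ^ k) *\<^sub>R z)"
      using M(2) iter_mem[OF x] by blast
    then show ?thesis
      using s(1) l by (simp add: mult_ac)
  qed
  then show "limsup (\<lambda>k. ennreal (root k (norm ((h ^^ k) x)))) \<le> b"
    unfolding b using l by (intro limsup_root_le) auto
qed

text \<open>For \<open>l > 0\<close> the iterates of an eigenvector are exactly \<open>l ^ k\<close>
  times it, so they grow at rate \<open>l\<close>; \<open>l = 0\<close> is below everything.\<close>

lemma eigenvalue_radius_le_spectral_radius:
  "cone_eigenvalue_spectral_radius C h \<le> cone_spectral_radius C h"
  unfolding cone_eigenvalue_spectral_radius_def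
proof (rule Sup_least)
  fix b assume "b \<in> {ennreal l |l. 0 \<le> l \<and> (\<exists>x\<in>C - {0}. h x = l *\<^sub>R x)}"
  then obtain l x where b: "b = ennreal l" and l: "0 \<le> l"
    and x: "x \<in> C" "x \<noteq> 0" and eq: "h x = l *\<^sub>R x"
    by blast
  have "ennreal l \<le> cone_spectral_radius C h"
  proof (cases "l = 0")
    case False
    have "ennreal l \<le> limsup (\<lambda>k. ennreal (root k (norm ((h ^^ k) x))))"
      using x l False iter_eigenvector[OF x(1) eq]
      by (intro limsup_root_ge[where D = "norm x"]) (auto simp: mult.commute)
    also have "\<dots> \<le> cone_spectral_radius C h"
      unfolding cone_spectral_radius_def using x(1) by (intro SUP_upper)
    finally show ?thesis .
  qed simp
  then show "b \<le> cone_spectral_radius C h"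
    unfolding b .
qed

section \<open>Solving the perturbed equation \<open>l x = h x + u\<close>\<close>

lemma fixed_point:
  assumes z: "z \<in> interior C" "h z \<preceq> m *\<^sub>R z" and m: "0 < m" "m < l"
  obtains x where "x \<in> C" and "l *\<^sub>R x = h x + u"
proof -
  have l: "0 < l" using m by simp
  have uC: "u \<in> C" and zC: "z \<in> C"
    using u_interior z(1) interior_mem by auto
  define T where "T x = (1 / l) *\<^sub>R (h x + u)" for x
  have T_mem: "T x \<in> C" if "x \<in> C" for x
    unfolding T_def using that l by (intro scale_mem add_mem map_mem uC) auto
  have T_mono: "T x \<preceq> T y" if "x \<in> C" "x \<preceq> y" for x y
    unfolding T_def using that l by (intro le_scale le_add map_mono le_refl) auto
  have T_ge: "(1 / l) *\<^sub>R u \<preceq> T x" if "x \<in> C" for x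
    using le_scale[of u "h x + u" "1 / l"] map_mem[OF that] l by (simp add: T_def cone_le_def)
  obtain Kz where Kz: "Kz > 0" "\<And>x. x \<preceq> (Kz * norm x) *\<^sub>R z"
    using order_unit z(1) by blast
  obtain K where K: "K > 0" "\<And>x. x \<preceq> (K * norm x) *\<^sub>R u"
    using order_unit u_interior by blast
  obtain M where M: "M > 0" "\<And>x y. x \<in> C \<Longrightarrow> x \<preceq> y \<Longrightarrow> norm x \<le> M * norm y"
    using normality by blast
  \<comment> \<open>With this \<open>R\<close> the slack \<open>(l - m) R z\<close> dominates
    \<open>u\<close>, so that \<open>T\<close> decreases the point \<open>w = R z\<close>.\<close>
  define R where "R = (Kz * norm u + 1) / (l - m)"
  have R: "0 < R" using m Kz(1) by (simp add: R_def add_nonneg_pos)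
  define w where "w = R *\<^sub>R z"
  have wC: "w \<in> C" using R zC by (simp add: w_def scale_mem)
  have Tw: "T w \<preceq> w"
  proof -
    have "u \<preceq> (Kz * norm u + 1) *\<^sub>R z"
      using Kz(2)[of u] by (rule le_trans) (simp add: scale_le_scale zC)
    also have "Kz * norm u + 1 = (l - m) * R"
      using m by (simp add: R_def)
    finally have "R *\<^sub>R h z + u \<preceq> R *\<^sub>R (m *\<^sub>R z) + ((l - m) * R) *\<^sub>R z"
      using R by (intro le_add le_scale z) auto
    then have "h w + u \<preceq> l *\<^sub>R w"
      using R zC by (simp add: w_def map_scale algebra_simps)
    then have "(1 / l) *\<^sub>R (h w + u) \<preceq> (1 / l) *\<^sub>R (l *\<^sub>R w)"
      using l by (intro le_scale) auto
    then show ?thesis using l by (simp add: T_def)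
  qed
  define X where "X n = (T ^^ n) w" for n
  have X_Suc: "X (Suc n) = T (X n)" for n by (simp add: X_def)
  have X_mem: "X n \<in> C" for n
    by (induction n) (auto simp: X_Suc T_mem, simp add: X_def wC)
  have X_dec: "X (Suc n) \<preceq> X n" for n
  proof (induction n)
    case 0
    show ?case using Tw by (simp add: X_def)
  next
    case (Suc n)
    then show ?case using T_mono[OF X_mem] by (metis X_Suc)
  qed
  have X_le: "X n \<preceq> w" for n
  proof (induction n)
    case 0
    show ?case by (simp add: X_def le_refl)
  next
    case (Suc n)
    then show ?case using X_dec le_trans by blast
  qed
  \<comment> \<open>\<open>L\<close> compares \<open>w\<close> with the lower bound
    \<open>u / l\<close> of the values of \<open>T\<close>: \<open>w\<close> is below
    \<open>L u / l\<close>. Hence \<open>u / l\<close> is above the fraction \<open>c\<close> of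
    every iterate. The summand 2 forces \<open>0 < c < 1\<close>.\<close>
  define L where "L = l * (K * norm w) + 2"
  define c where "c = 1 / L"
  have L: "L \<ge> 2" using l K(1) by (simp add: L_def)
  have c: "0 < c" "c < 1" using L by (auto simp: c_def)
  have w_le: "w \<preceq> (L / l) *\<^sub>R u"
    using K(2)[of w] by (rule le_trans) (use l in \<open>auto intro!: scale_le_scale uC simp: L_def field_simps\<close>)
  have c_le: "c *\<^sub>R X n \<preceq> (1 / l) *\<^sub>R u" for n
    using le_scale[OF le_trans[OF X_le[of n] w_le], of c] c L by (simp add: c_def)
  \<comment> \<open>A bound for the ratio of consecutive iterates: it starts at \<open>L\<close>,
    and its excess over 1 is multiplied by \<open>1 - c\<close> in each step.\<close>
  define \<beta> where "\<beta> n = 1 + (L - 1) * (1 - c) ^ n" for n :: nat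
  have \<beta>1: "\<beta> n \<ge> 1" for n using L c by (simp add: \<beta>_def)
  have X_ratio: "X n \<preceq> \<beta> n *\<^sub>R X (Suc n)" for n
  proof (induction n)
    case 0
    have "w \<preceq> L *\<^sub>R ((1 / l) *\<^sub>R u)" using w_le by simp
    also have "L *\<^sub>R ((1 / l) *\<^sub>R u) \<preceq> L *\<^sub>R T w"
      using T_ge[OF wC] L by (intro le_scale) auto
    finally show ?case by (simp add: X_def \<beta>_def)
  next
    case (Suc n)
    have "X (Suc n) \<preceq> T (\<beta> n *\<^sub>R X (Suc n))"
      using T_mono[OF X_mem Suc] by (simp add: X_Suc)
    \<comment> \<open>The summand \<open>u / l\<close> of \<open>T\<close> does not scale, which
      leaves a gain of \<open>(\<beta> n - 1) u / l\<close>. Replacing \<open>u / l\<close> by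
      \<open>c\<close> times the next iterate lowers the factor to
      \<open>\<beta> (Suc n)\<close>.\<close>
    also have "T (\<beta> n *\<^sub>R X (Suc n)) = \<beta> n *\<^sub>R X (Suc (Suc n)) - (\<beta> n - 1) *\<^sub>R ((1 / l) *\<^sub>R u)"
      using \<beta>1[of n] by (simp add: T_def X_Suc[of "Suc n"] map_scale X_mem algebra_simps)
    also have "\<dots> \<preceq> \<beta> n *\<^sub>R X (Suc (Suc n)) - (\<beta> n - 1) *\<^sub>R (c *\<^sub>R X (Suc (Suc n)))"
      using le_scale[OF c_le[of "Suc (Suc n)"], of "\<beta> n - 1"] \<beta>1[of n]
      by (simp add: cone_le_def)
    also have "\<dots> = \<beta> (Suc n) *\<^sub>R X (Suc (Suc n))"
      by (simp add: \<beta>_def algebra_simps)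
    finally show ?case .
  qed
  \<comment> \<open>The decrement lies between 0 and \<open>(\<beta> n - 1) w\<close>, so normality
    bounds its norm geometrically; completeness then yields a limit.\<close>
  have X_step: "norm (X n - X (Suc n)) \<le> (M * (L - 1) * norm w) * (1 - c) ^ n" for n
  proof -
    have "X n - X (Suc n) \<preceq> (\<beta> n - 1) *\<^sub>R X (Suc n)"
      using X_ratio[of n] by (simp add: cone_le_def algebra_simps)
    also have "\<dots> \<preceq> (\<beta> n - 1) *\<^sub>R w"
      using \<beta>1[of n] by (intro le_scale X_le) auto
    finally have "norm (X n - X (Suc n)) \<le> M * norm ((\<beta> n - 1) *\<^sub>R w)"
      using X_dec[of n] by (intro M(2)) (simp_all add: cone_le_def)
    also have "\<dots> = (M * (L - 1) * norm w) * (1 - c) ^ n"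
      using L c by (simp add: \<beta>_def abs_mult)
    finally show ?thesis .
  qed
  have "summable (\<lambda>n. X (Suc n) - X n)"
  proof (rule summable_comparison_test)
    show "\<exists>N. \<forall>n\<ge>N. norm (X (Suc n) - X n) \<le> (M * (L - 1) * norm w) * (1 - c) ^ n"
      using X_step by (auto simp: norm_minus_commute)
    show "summable (\<lambda>n. (M * (L - 1) * norm w) * (1 - c) ^ n)"
      using c by (intro summable_mult summable_geometric) auto
  qed
  then have "convergent (\<lambda>n. \<Sum>i<n. X (Suc i) - X i)"
    by (simp add: summable_iff_convergent)
  then have "convergent (\<lambda>n. (\<Sum>i<n. X (Suc i) - X i) + X 0)"
    by (rule convergent_add) (rule convergent_const)
  moreover have "(\<lambda>n. (\<Sum>i<n. X (Suc i) - X i) + X 0) = X"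
    by (auto simp: sum_lessThan_telescope)
  ultimately have "convergent X" by simp
  then obtain x where x: "X \<longlonglongrightarrow> x"
    unfolding convergent_def by blast
  have xC: "x \<in> C"
    using closed_sequentially[OF closed_C] X_mem x by blast
  have "(\<lambda>n. h (X n)) \<longlonglongrightarrow> h x"
    using continuous_on_tendsto_compose[OF cont x xC] X_mem by simp
  then have "(\<lambda>n. T (X n)) \<longlonglongrightarrow> T x"
    unfolding T_def by (intro tendsto_intros)
  moreover have "(\<lambda>n. T (X n)) \<longlonglongrightarrow> x"
    using LIMSEQ_Suc[OF x] by (simp add: X_Suc)
  ultimately have "T x = x"
    using LIMSEQ_unique by blast
  then have "l *\<^sub>R x = h x + u"
    using l by (metis T_def divide_self_if less_irrefl scaleR_one scaleR_scaleR times_divide_eq_right mult.right_neutral)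
  with xC show ?thesis
    using that by blast
qed

section \<open>Approximate eigenvectors for the Collatz-Wielandt number\<close>

lemma approximate_eigenvector:
  assumes cw: "collatz_wielandt_number C h = ennreal r" and r: "0 < r" and \<delta>: "0 < \<delta>"
  obtains y where "y \<in> C" and "norm y = 1" and "norm (h y - r *\<^sub>R y) \<le> \<delta>"
proof -
  have uC: "u \<in> C" using u_interior interior_mem by blast
  have r_le: "r \<le> l" if "0 < l" "z \<in> interior C" "h z \<preceq> l *\<^sub>R z" for l z
    using cw_le[OF that] cw that(1) by simp
  obtain K where K: "K > 0" "\<And>x. x \<preceq> (K * norm x) *\<^sub>R u"
    using order_unit u_interior by blast
  \<comment> \<open>Chosen so that the final error \<open>\<eta> * (1 + K * norm u)\<close> equals
    \<open>\<delta>\<close>.\<close>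
  define \<eta> where "\<eta> = \<delta> / (1 + K * norm u)"
  have K1: "0 < 1 + K * norm u" using K(1) by (simp add: add_pos_nonneg)
  have \<eta>: "0 < \<eta>" using \<delta> K1 by (simp add: \<eta>_def)
  define l where "l = r + \<eta>"
  have "collatz_wielandt_number C h < ennreal l"
    using \<eta> r by (simp add: cw l_def ennreal_less_iff)
  then obtain m z where m: "0 < m" "m < l" and z: "z \<in> interior C" "h z \<preceq> m *\<^sub>R z"
    unfolding collatz_wielandt_number_def Inf_less_iff
    by (auto simp: ennreal_less_iff)
  obtain x where xC: "x \<in> C" and x: "l *\<^sub>R x = h x + u"
    using fixed_point[OF z m] by blast
  have l: "0 < l" using m by simp
  \<comment> \<open>If \<open>u = 0\<close>, then \<open>h u = 0\<close> and every positive factor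
    is admissible at the interior point \<open>u\<close>, against \<open>r > 0\<close>.\<close>
  have x0: "x \<noteq> 0"
  proof
    assume "x = 0"
    then have "u = 0" using x by (simp add: map_zero)
    then have "r \<le> r / 2"
      using r_le[of "r / 2" u] u_interior r by (simp add: map_zero le_refl)
    then show False using r by simp
  qed
  have x_int: "x \<in> interior C"
  proof (rule interior_upward)
    show "(1 / l) *\<^sub>R u \<in> interior C"
      using l u_interior by (simp add: interior_scale)
    have "u \<preceq> l *\<^sub>R x" using x map_mem[OF xC] by (simp add: cone_le_def)
    then have "(1 / l) *\<^sub>R u \<preceq> (1 / l) *\<^sub>R (l *\<^sub>R x)"
      using l by (intro le_scale) auto
    then show "(1 / l) *\<^sub>R u \<preceq> x" using l by simp
  qed
  \<comment> \<open>The order unit bound gives \<open>q x\<close> below \<open>u\<close>, so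
    subtracting \<open>u\<close> in \<open>h x = l x - u\<close> lowers the factor from
    \<open>l\<close> to \<open>l - q\<close>.\<close>
  define q where "q = 1 / (K * norm x)"
  have q: "0 < q" using K(1) x0 by (simp add: q_def)
  have "q *\<^sub>R x \<preceq> q *\<^sub>R ((K * norm x) *\<^sub>R u)"
    using K(2) q by (intro le_scale) auto
  then have qx: "q *\<^sub>R x \<preceq> u"
    using K(1) x0 by (simp add: q_def)
  have "h x = l *\<^sub>R x - u" using x by simp
  moreover have "l *\<^sub>R x - u \<preceq> (l - q) *\<^sub>R x"
    using qx by (simp add: cone_le_def algebra_simps)
  ultimately have hx: "h x \<preceq> (l - q) *\<^sub>R x"
    by simp
  \<comment> \<open>Admissible factors are positive, which \<open>l - q\<close> need not be. As
    \<open>r / 2 < r\<close>, the maximum still gives \<open>r \<le> l - q\<close>, that is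
    \<open>q \<le> \<eta>\<close>: the norm of \<open>x\<close> is at least
    \<open>1 / (K \<eta>)\<close>.\<close>
  have "h x \<preceq> max (l - q) (r / 2) *\<^sub>R x"
    using hx by (rule le_trans) (simp add: scale_le_scale xC)
  then have "r \<le> max (l - q) (r / 2)"
    using r_le[OF _ x_int] r by (simp add: less_max_iff_disj)
  then have q_le: "q \<le> \<eta>" using r by (auto simp: l_def max_def split: if_splits)
  define y where "y = (1 / norm x) *\<^sub>R x"
  have yC: "y \<in> C" using xC by (simp add: y_def scale_mem)
  have ny: "norm y = 1" using x0 by (simp add: y_def)
  have "h y = (1 / norm x) *\<^sub>R h x"
    using xC x0 by (simp add: y_def map_scale)
  also have "\<dots> = l *\<^sub>R y - (1 / norm x) *\<^sub>R u"
    unfolding \<open>h x = l *\<^sub>R x - u\<close> by (simp add: y_def scaleR_diff_right)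
  finally have "h y - r *\<^sub>R y = \<eta> *\<^sub>R y - (q * K) *\<^sub>R u"
    using K(1) by (simp add: l_def q_def algebra_simps)
  also have "norm \<dots> \<le> \<eta> + (q * K) * norm u"
    using norm_triangle_ineq4[of "\<eta> *\<^sub>R y" "(q * K) *\<^sub>R u"] ny \<eta> q K(1)
    by (simp add: abs_mult)
  also have "\<dots> \<le> \<eta> + \<eta> * K * norm u"
    using q_le K(1) by (intro add_left_mono mult_right_mono) auto
  also have "\<dots> = \<eta> * (1 + K * norm u)" by (simp add: algebra_simps)
  also have "\<dots> = \<delta>" using K1 by (simp add: \<eta>_def)
  finally show ?thesis using that yC ny by blast
qed

lemma approximate_eigenvector_sequence:
  assumes "collatz_wielandt_number C h = ennreal r" and "0 < r"
  obtains y :: "nat \<Rightarrow> 'a" where "\<And>n. y n \<in> C" and "\<And>n. norm (y n) = 1"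
    and "(\<lambda>n. h (y n) - r *\<^sub>R y n) \<longlonglongrightarrow> 0"
proof -
  have "\<exists>y. y \<in> C \<and> norm y = 1 \<and> norm (h y - r *\<^sub>R y) \<le> 1 / real (Suc n)" for n
    using approximate_eigenvector[OF assms, of "1 / real (Suc n)"] by auto
  then obtain y where y: "\<And>n. y n \<in> C" "\<And>n. norm (y n) = 1"
    "\<And>n. norm (h (y n) - r *\<^sub>R y n) \<le> 1 / real (Suc n)"
    by metis
  have "(\<lambda>n. h (y n) - r *\<^sub>R y n) \<longlonglongrightarrow> 0"
    by (rule Lim_null_comparison[OF _ LIMSEQ_Suc[OF lim_1_over_n]]) (use y(3) in auto)
  then show ?thesis using that y by blast
qed

text \<open>By induction: uniform continuity carries the error of the \<open>k\<close>-th iterate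
  through one more application of \<open>h\<close>, and homogeneity turns the rest into
  \<open>r ^ k\<close> times the original error.\<close>

lemma iterated_approximate_eigenvectors:
  assumes uc: "uniformly_continuous_on_bounded_subsets C h" and r: "0 < r"
    and y: "\<And>n. y n \<in> C" "\<And>n. norm (y n) = 1"
    and lim: "(\<lambda>n. h (y n) - r *\<^sub>R y n) \<longlonglongrightarrow> 0"
  shows "(\<lambda>n. (h ^^ k) (y n) - (r ^ k) *\<^sub>R y n) \<longlonglongrightarrow> 0"
proof (induction k)
  case 0
  show ?case by simp
next
  case (Suc k)
  define a where "a n = (h ^^ k) (y n)" for n
  define b where "b n = (r ^ k) *\<^sub>R y n" for n
  have ab: "(\<lambda>n. a n - b n) \<longlonglongrightarrow> 0" using Suc by (simp add: a_def b_def)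
  have bC: "b n \<in> C" and aC: "a n \<in> C" for n
    using y r by (auto simp: a_def b_def scale_mem iter_mem)
  have b_bd: "bounded (range b)"
    using y r by (auto simp: bounded_iff b_def intro!: exI[of _ "r ^ k"])
  \<comment> \<open>The iterates \<open>a\<close> are bounded as the sum of a null sequence and the
    bounded sequence \<open>b\<close>.\<close>
  have "bounded (range (\<lambda>n. a n - b n))"
    using ab convergent_imp_bounded by blast
  then have "bounded (range (\<lambda>n. (a n - b n) + b n))"
    using b_bd bounded_plus_comp by blast
  then have "bounded (range a \<union> range b)"
    using b_bd by simp
  then have "uniformly_continuous_on (range a \<union> range b) h"
    using uc aC bC by (simp add: uniformly_continuous_on_bounded_subsets_def image_subset_iff)
  moreover have "(\<lambda>n. dist (a n) (b n)) \<longlonglongrightarrow> 0"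
    unfolding dist_norm using ab by (rule tendsto_norm_zero)
  ultimately have "(\<lambda>n. dist (h (a n)) (h (b n))) \<longlonglongrightarrow> 0"
    unfolding uniformly_continuous_on_sequentially by simp
  then have "(\<lambda>n. h (a n) - h (b n)) \<longlonglongrightarrow> 0"
    unfolding dist_norm by (rule tendsto_norm_zero_cancel)
  then have "(\<lambda>n. (h (a n) - h (b n)) + (r ^ k) *\<^sub>R (h (y n) - r *\<^sub>R y n)) \<longlonglongrightarrow> 0 + (r ^ k) *\<^sub>R 0"
    using lim by (intro tendsto_intros)
  moreover have "(h (a n) - h (b n)) + (r ^ k) *\<^sub>R (h (y n) - r *\<^sub>R y n)
      = (h ^^ Suc k) (y n) - (r ^ Suc k) *\<^sub>R y n" for n
    using r y(1) by (simp add: a_def b_def map_scale algebra_simps)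
  ultimately show ?case by simp
qed

text \<open>The orbit of \<open>u\<close> attains the growth: all \<open>y n\<close> lie below
  \<open>K u\<close>, and for fixed \<open>k\<close> the norms of their iterates tend to
  \<open>r ^ k\<close>. Normality gives a lower bound whose constant \<open>1 / (M K)\<close> is
  independent of \<open>k\<close>.\<close>

lemma cw_le_spectral_radius_if_uniformly_continuous:
  assumes uc: "uniformly_continuous_on_bounded_subsets C h"
    and cw: "collatz_wielandt_number C h = ennreal r" and r: "0 < r"
  shows "ennreal r \<le> cone_spectral_radius C h"
proof -
  have uC: "u \<in> C" using u_interior interior_mem by blast
  obtain K where K: "K > 0" "\<And>x. x \<preceq> (K * norm x) *\<^sub>R u"
    using order_unit u_interior by blast
  obtain M where M: "M > 0" "\<And>x y. x \<in> C \<Longrightarrow> x \<preceq> y \<Longrightarrow> norm x \<le> M * norm y"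
    using normality by blast
  obtain y where y: "\<And>n. y n \<in> C" "\<And>n. norm (y n) = 1"
    and lim: "(\<lambda>n. h (y n) - r *\<^sub>R y n) \<longlonglongrightarrow> 0"
    using approximate_eigenvector_sequence[OF cw r] by blast
  have "(1 / (M * K)) * r ^ k \<le> norm ((h ^^ k) u)" for k
  proof -
    have "(\<lambda>n. r ^ k - norm ((h ^^ k) (y n) - (r ^ k) *\<^sub>R y n)) \<longlonglongrightarrow> r ^ k - norm (0 :: 'a)"
      by (intro tendsto_intros iterated_approximate_eigenvectors[OF uc r y lim])
    then have "r ^ k - norm (0 :: 'a) \<le> M * K * norm ((h ^^ k) u)"
    proof (rule LIMSEQ_le_const2)
      have "r ^ k - norm ((h ^^ k) (y n) - (r ^ k) *\<^sub>R y n) \<le> M * K * norm ((h ^^ k) u)" for n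
      proof -
        have "y n \<preceq> K *\<^sub>R u" using K(2)[of "y n"] y(2) by simp
        then have "(h ^^ k) (y n) \<preceq> K *\<^sub>R (h ^^ k) u"
          using iter_mono[OF y(1)] iter_scale[OF uC K(1)] by metis
        then have "norm ((h ^^ k) (y n)) \<le> M * norm (K *\<^sub>R (h ^^ k) u)"
          using M(2) iter_mem[OF y(1)] by blast
        then have "norm ((h ^^ k) (y n)) \<le> M * K * norm ((h ^^ k) u)"
          using K(1) by simp
        moreover have "norm ((r ^ k) *\<^sub>R y n) = r ^ k"
          using r y(2) by simp
        ultimately show ?thesis
          using norm_triangle_ineq2[of "(r ^ k) *\<^sub>R y n" "(h ^^ k) (y n)"]
          by (simp add: norm_minus_commute)
      qed
      then show "\<exists>N. \<forall>n\<ge>N. r ^ k - norm ((h ^^ k) (y n) - (r ^ k) *\<^sub>R y n)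
          \<le> M * K * norm ((h ^^ k) u)"
        by blast
    qed
    then show ?thesis
      using M(1) K(1) by (simp add: field_simps)
  qed
  then have "ennreal r \<le> limsup (\<lambda>k. ennreal (root k (norm ((h ^^ k) u))))"
    using M(1) K(1) r by (intro limsup_root_ge[where D = "1 / (M * K)"]) auto
  also have "\<dots> \<le> cone_spectral_radius C h"
    unfolding cone_spectral_radius_def using uC by (intro SUP_upper)
  finally show ?thesis .
qed

section \<open>Exact eigenvectors from the measure of noncompactness\<close>

lemma eigenvector_if_condensing:
  assumes mnc: "homogeneous_gen_mnc \<nu>" and r: "0 < r"
    and condensing: "mnc_seminorm \<nu> C (h ^^ k) < ennreal (r ^ k)"
    and y: "\<And>n. y n \<in> C" "\<And>n. norm (y n) = 1"
    and lim: "(\<lambda>n. h (y n) - r *\<^sub>R y n) \<longlonglongrightarrow> 0"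
    and limk: "(\<lambda>n. (h ^^ k) (y n) - (r ^ k) *\<^sub>R y n) \<longlonglongrightarrow> 0"
  obtains x where "x \<in> C - {0}" and "h x = r *\<^sub>R x"
proof -
  have \<nu>_nonneg: "0 \<le> \<nu> S" and \<nu>_zero_iff: "\<nu> S = 0 \<longleftrightarrow> compact (closure S)"
    and \<nu>_scale: "\<nu> ((*\<^sub>R) c ` S) = \<bar>c\<bar> * \<nu> S" if "bounded S" for S c
    using mnc that by (simp_all add: homogeneous_gen_mnc_def)
  have \<nu>_add: "\<nu> (S + T) \<le> \<nu> S + \<nu> T" if "bounded S" "bounded T" for S T
    using mnc that by (simp add: homogeneous_gen_mnc_def)
  have \<nu>_mono: "\<nu> S \<le> \<nu> T" if "bounded T" "S \<subseteq> T" for S T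
    using mnc that bounded_subset[OF that] by (simp add: homogeneous_gen_mnc_def)
  obtain l where "0 < l" and "ennreal l < ennreal (r ^ k)"
    and cond: "\<forall>A. A \<subseteq> C \<and> bounded A \<longrightarrow>
      bounded ((h ^^ k) ` A) \<and> \<nu> ((h ^^ k) ` A) \<le> l * \<nu> A"
    using condensing unfolding mnc_seminorm_def Inf_less_iff by blast
  then have l: "0 < l" "l < r ^ k"
    by (simp_all add: ennreal_less_iff)
  define A where "A = range y"
  have A: "A \<subseteq> C" "bounded A"
    using y by (auto simp: A_def bounded_iff intro!: exI[of _ 1])
  define H where "H = (h ^^ k) ` A"
  have H: "bounded H" "\<nu> H \<le> l * \<nu> A"
    using cond A by (simp_all add: H_def)
  define e where "e n = (r ^ k) *\<^sub>R y n - (h ^^ k) (y n)" for n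
  have e0: "e \<longlonglongrightarrow> 0"
    using tendsto_minus[OF limk] by (simp add: e_def[abs_def])
  have e_bd: "bounded (range e)"
    using e0 convergent_imp_bounded by blast
  have "compact (closure (range e))"
  proof -
    have K: "compact (insert 0 (range e))"
      using e0 by (rule compact_insert_limit)
    then have "closure (range e) \<subseteq> insert 0 (range e)"
      by (intro closure_minimal compact_imp_closed) auto
    then show ?thesis
      using compact_Int_closed[OF K closed_closure] by (metis inf.absorb_iff2)
  qed
  then have \<nu>e: "\<nu> (range e) = 0"
    using \<nu>_zero_iff[OF e_bd] by simp
  have HE: "bounded (H + range e)"
    unfolding set_plus_image using H(1) e_bd by (rule bounded_plus)
  \<comment> \<open>Up to the factor \<open>1 / r ^ k\<close>, \<open>A\<close> sits in its own
    image plus a relatively compact error set. Hence \<open>\<nu> A\<close> is at most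
    \<open>l / r ^ k < 1\<close> times itself and vanishes.\<close>
  have "A \<subseteq> (*\<^sub>R) (1 / r ^ k) ` (H + range e)"
  proof
    fix v assume "v \<in> A"
    then obtain n where v: "v = y n" by (auto simp: A_def)
    have "(h ^^ k) (y n) + e n \<in> H + range e"
      by (intro set_plus_intro) (auto simp: H_def A_def)
    moreover have "y n = (1 / r ^ k) *\<^sub>R ((h ^^ k) (y n) + e n)"
      using r by (simp add: e_def)
    ultimately show "v \<in> (*\<^sub>R) (1 / r ^ k) ` (H + range e)"
      unfolding v by blast
  qed
  then have "\<nu> A \<le> \<nu> ((*\<^sub>R) (1 / r ^ k) ` (H + range e))"
    by (intro \<nu>_mono bounded_scaling HE)
  also have "\<dots> = \<bar>1 / r ^ k\<bar> * \<nu> (H + range e)"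
    by (intro \<nu>_scale HE)
  also have "\<dots> \<le> \<bar>1 / r ^ k\<bar> * (\<nu> H + \<nu> (range e))"
    using \<nu>_add[OF H(1) e_bd] by (intro mult_left_mono) auto
  also have "\<dots> \<le> (l * \<nu> A) / r ^ k"
    using H(2) \<nu>e r by (simp add: divide_right_mono)
  finally have "r ^ k * \<nu> A \<le> l * \<nu> A"
    using r by (simp add: field_simps)
  moreover have "0 \<le> \<nu> A"
    by (intro \<nu>_nonneg A)
  ultimately have "\<nu> A = 0"
    using l by (metis mult_le_cancel_right not_le order_antisym_conv)
  then have "compact (closure A)"
    using \<nu>_zero_iff[OF A(2)] by simp
  moreover have "\<And>n. y n \<in> closure A"
    using closure_subset[of A] by (auto simp: A_def)
  ultimately obtain x s where s: "strict_mono (s :: nat \<Rightarrow> nat)" and x: "(y \<circ> s) \<longlonglongrightarrow> x"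
    unfolding compact_def by metis
  have xC: "x \<in> C"
    using closed_sequentially[OF closed_C _ x] y(1) by simp
  have "(\<lambda>n. norm ((y \<circ> s) n)) \<longlonglongrightarrow> norm x"
    using x by (rule tendsto_norm)
  then have "norm x = 1"
    using y(2) by (simp add: LIMSEQ_const_iff)
  \<comment> \<open>Compactness came from the \<open>k\<close>-th iterate, but the limit is
    identified through \<open>lim\<close>, so \<open>x\<close> is an eigenvector of \<open>h\<close>
    itself.\<close>
  have "(\<lambda>n. h ((y \<circ> s) n)) \<longlonglongrightarrow> h x"
    using continuous_on_tendsto_compose[OF cont x xC] y(1) by simp
  then have "(\<lambda>n. h ((y \<circ> s) n) - r *\<^sub>R (y \<circ> s) n) \<longlonglongrightarrow> h x - r *\<^sub>R x"
    using x by (intro tendsto_intros)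
  moreover have "(\<lambda>n. h ((y \<circ> s) n) - r *\<^sub>R (y \<circ> s) n) \<longlonglongrightarrow> 0"
    using LIMSEQ_subseq_LIMSEQ[OF lim s] by (simp add: o_def)
  ultimately have "h x = r *\<^sub>R x"
    using LIMSEQ_unique by fastforce
  moreover have "x \<noteq> 0" using \<open>norm x = 1\<close> by auto
  ultimately show ?thesis
    using that xC by simp
qed

text \<open>Condition (ii) is the case \<open>k = 1\<close>, where the relation for the iterate is
  \<open>lim\<close> itself. Under (i) and (iii) the infimum formula supplies some \<open>k\<close>,
  and uniform continuity supplies the relation for \<open>h ^^ k\<close>.\<close>

lemma eigenvector_at_cw:
  assumes mnc: "homogeneous_gen_mnc \<nu>"
    and cond: "(uniformly_continuous_on_bounded_subsets C h \<and>
        cone_essential_spectral_radius \<nu> C h < collatz_wielandt_number C h) \<or>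
      mnc_seminorm \<nu> C h < collatz_wielandt_number C h"
    and cw: "collatz_wielandt_number C h = ennreal r" and r: "0 < r"
  obtains x where "x \<in> C - {0}" and "h x = r *\<^sub>R x"
proof -
  obtain y where y: "\<And>n. y n \<in> C" "\<And>n. norm (y n) = 1"
    and lim: "(\<lambda>n. h (y n) - r *\<^sub>R y n) \<longlonglongrightarrow> 0"
    using approximate_eigenvector_sequence[OF cw r] by blast
  from cond show ?thesis
  proof
    assume "mnc_seminorm \<nu> C h < collatz_wielandt_number C h"
    then have "mnc_seminorm \<nu> C (h ^^ 1) < ennreal (r ^ 1)"
      by (simp add: cw)
    then show ?thesis
      by (rule eigenvector_if_condensing[OF mnc r _ y lim _ that]) (use lim in auto)
  next
    assume *: "uniformly_continuous_on_bounded_subsets C h \<and>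
      cone_essential_spectral_radius \<nu> C h < collatz_wielandt_number C h"
    then obtain k where k: "1 \<le> k" "ennroot k (mnc_seminorm \<nu> C (h ^^ k)) < ennreal r"
      unfolding cone_essential_spectral_radius_def INF_less_iff cw by auto
    define a where "a = enn2real (mnc_seminorm \<nu> C (h ^^ k))"
    \<comment> \<open>\<open>enn2real\<close> sends \<open>top\<close> to 0, so the infinite value
      must be excluded before passing to reals; \<open>ennroot\<close> keeps \<open>top\<close>
      infinite.\<close>
    have fin: "mnc_seminorm \<nu> C (h ^^ k) \<noteq> top"
      using k(2) by (auto simp: ennroot_def)
    then have "root k a < r"
      using k by (simp add: ennroot_def a_def ennreal_less_iff)
    then have "root k a ^ k < r ^ k"
      using k(1) by (intro power_strict_mono) (auto simp: a_def)
    then have "ennreal a < ennreal (r ^ k)"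
      using k(1) by (simp add: a_def ennreal_less_iff)
    then have "mnc_seminorm \<nu> C (h ^^ k) < ennreal (r ^ k)"
      using fin by (simp add: a_def ennreal_enn2real_if)
    then show ?thesis
      using eigenvector_if_condensing[OF mnc r _ y lim
          iterated_approximate_eigenvectors[OF conjunct1[OF *] r y lim]] that by blast
  qed
qed

end

section \<open>Combination of the bounds\<close>

theorem theorem7p4:
  fixes C :: "'a::banach set" and h :: "'a \<Rightarrow> 'a" and \<nu> :: "'a set \<Rightarrow> real"
  assumes "homogeneous_gen_mnc \<nu>"
    and "normal_cone C" and "interior C \<noteq> {}"
    and "h \<in> C \<rightarrow> C" and "continuous_on C h"
    and "homogeneous_on C h" and "order_preserving_on C h"
  shows "(uniformly_continuous_on_bounded_subsets C h \<or>
          mnc_seminorm \<nu> C h < collatz_wielandt_number C h \<longrightarrow>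
            cone_spectral_radius C h = collatz_wielandt_number C h) \<and>
         ((uniformly_continuous_on_bounded_subsets C h \<and>
            cone_essential_spectral_radius \<nu> C h < collatz_wielandt_number C h) \<or>
          mnc_seminorm \<nu> C h < collatz_wielandt_number C h \<longrightarrow>
            cone_eigenvalue_spectral_radius C h = cone_spectral_radius C h \<and>
            cone_spectral_radius C h < top \<and>
            (\<exists>x \<in> C - {0}. h x = enn2real (cone_spectral_radius C h) *\<^sub>R x))"
    (is "(?uc \<or> ?ii \<longrightarrow> ?eq) \<and> (?uc \<and> ?iii \<or> ?ii \<longrightarrow> ?concl)")
proof -
  obtain u where "u \<in> interior C"
    using assms(3) by blast
  then interpret solid_normal_cone_map C h u
    using assms by unfold_locales
  define r where "r = enn2real (collatz_wielandt_number C h)"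
  have cw: "collatz_wielandt_number C h = ennreal r"
    using cw_finite by (simp add: r_def)
  have r0: "0 \<le> r" by (simp add: r_def)
  \<comment> \<open>The strict inequality in \<open>cond\<close> makes \<open>r\<close> positive,
    and an eigenvector for \<open>r\<close> closes the chain of inequalities from the eigenvalue
    radius through the spectral radius to \<open>r\<close>.\<close>
  have all_eq: "?eq \<and> ?concl" if cond: "?uc \<and> ?iii \<or> ?ii"
  proof -
    have "0 < collatz_wielandt_number C h"
      using cond by (auto intro: le_less_trans[OF zero_le])
    then have r: "0 < r" by (simp add: cw)
    obtain x where x: "x \<in> C - {0}" "h x = r *\<^sub>R x"
      using eigenvector_at_cw[OF assms(1) cond cw r] by blast
    have "ennreal r \<le> cone_eigenvalue_spectral_radius C h"
      unfolding cone_eigenvalue_spectral_radius_def using x r0 by (intro Sup_upper) auto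
    then have "cone_eigenvalue_spectral_radius C h = ennreal r" "cone_spectral_radius C h = ennreal r"
      using eigenvalue_radius_le_spectral_radius spectral_radius_le_cw cw by auto
    then show ?thesis
      using x r0 cw by auto
  qed
  \<comment> \<open>Approximate eigenvectors are available for \<open>r > 0\<close>; for
    \<open>r = 0\<close> the upper bound already forces equality.\<close>
  have "?eq" if "?uc"
  proof (cases "r = 0")
    case True
    then show ?thesis using spectral_radius_le_cw cw by simp
  next
    case False
    then show ?thesis
      using cw_le_spectral_radius_if_uniformly_continuous[OF that cw] r0 spectral_radius_le_cw cw
      by simp
  qed
  with all_eq show ?thesis by blast
qed

end
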